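(* Let $L_i$, $V_i$, $i=1,2$, be finite-dimensional vector spaces over a field $F$ and let $\varphi_i\colon L_i\times L_i\to V_i$ be bilinear skew-symmetric maps. Denote $L=L_1\oplus L_2$, $V=V_1\oplus V_2$, and let $\varphi\colon L\times L\to V$ be the bilinear skew-symmetric map such that $\varphi|_{L_i\times L_i}=\varphi_i$, $i=1,2$, and $\varphi|_{L_1\times L_2}=0$; i.e., $$\varphi(x,y)=\varphi_1(x_1,y_1)+\varphi_2(x_2,y_2),$$ where $x_i,y_i\in L_i$ are the projections of $x,y\in L$. Then: (1) A subspace $H\subseteq L$ is maximal isotropic if and only if $H=H_1\oplus H_2$, where $H_i\subseteq L_i$ are maximal isotropic under $\varphi_i$. (2) $\mathcal{H}(\varphi)=\mathcal{H}(\varphi_1)+\mathcal{H}(\varphi_2)$. (3) $h(\varphi)=h(\varphi_1)+h(\varphi_2)$.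
   Context: For a bilinear map $\psi\colon U\times U\to W$ of finite-dimensional vector spaces, a subspace $H\subseteq U$ is isotropic under $\psi$ if $\psi(u_1,u_2)=0$ for all $u_1,u_2\in H$; it is maximal isotropic if it is isotropic and not properly contained in another isotropic subspace. $\mathcal{H}(\psi)$ is the set of dimensions of all maximal isotropic subspaces of $U$, and $h(\psi)=\max\mathcal{H}(\psi)$ (the isotropy index). For sets $A,B$ of integers, $A+B=\{a+b\mid a\in A,\ b\in B\}$. Skew-symmetric means $\psi(x,y)=-\psi(y,x)$ for all $x,y$ (so in characteristic $2$, $\psi(x,x)$ need not vanish). *)

theory Defs
  imports "HOL-Analysis.Product_Vector" "HOL-Library.Set_Algebras"
begin

definition fin_dim_vector_space :: "('f::field \<Rightarrow> 'u::ab_group_add \<Rightarrow> 'u) \<Rightarrow> bool"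
  where "fin_dim_vector_space s \<longleftrightarrow> (\<exists>B. finite_dimensional_vector_space s B)"

definition bilinear_map ::
  "('f::field \<Rightarrow> 'u::ab_group_add \<Rightarrow> 'u) \<Rightarrow> ('f \<Rightarrow> 'w::ab_group_add \<Rightarrow> 'w)
     \<Rightarrow> ('u \<Rightarrow> 'u \<Rightarrow> 'w) \<Rightarrow> bool"
  where "bilinear_map sU sW \<psi> \<longleftrightarrow>
    (\<forall>x. Vector_Spaces.linear sU sW (\<lambda>y. \<psi> x y)) \<and>
    (\<forall>y. Vector_Spaces.linear sU sW (\<lambda>x. \<psi> x y))"

text \<open>In characteristic 2 this does not force \<open>\<psi> x x = 0\<close>.\<close>

definition skew_symmetric :: "('u \<Rightarrow> 'u \<Rightarrow> 'w::ab_group_add) \<Rightarrow> bool"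
  where "skew_symmetric \<psi> \<longleftrightarrow> (\<forall>x y. \<psi> x y = - \<psi> y x)"

definition isotropic ::
  "('f::field \<Rightarrow> 'u::ab_group_add \<Rightarrow> 'u) \<Rightarrow> ('u \<Rightarrow> 'u \<Rightarrow> 'w::zero) \<Rightarrow> 'u set \<Rightarrow> bool"
  where "isotropic sU \<psi> H \<longleftrightarrow>
    module.subspace sU H \<and> (\<forall>u1\<in>H. \<forall>u2\<in>H. \<psi> u1 u2 = 0)"

definition maximal_isotropic ::
  "('f::field \<Rightarrow> 'u::ab_group_add \<Rightarrow> 'u) \<Rightarrow> ('u \<Rightarrow> 'u \<Rightarrow> 'w::zero) \<Rightarrow> 'u set \<Rightarrow> bool"
  where "maximal_isotropic sU \<psi> H \<longleftrightarrow>
    isotropic sU \<psi> H \<and> \<not> (\<exists>H'. isotropic sU \<psi> H' \<and> H \<subset> H')"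

definition isotropic_dims ::
  "('f::field \<Rightarrow> 'u::ab_group_add \<Rightarrow> 'u) \<Rightarrow> ('u \<Rightarrow> 'u \<Rightarrow> 'w::zero) \<Rightarrow> nat set"
  where "isotropic_dims sU \<psi> = {vector_space.dim sU H | H. maximal_isotropic sU \<psi> H}"

definition isotropy_index ::
  "('f::field \<Rightarrow> 'u::ab_group_add \<Rightarrow> 'u) \<Rightarrow> ('u \<Rightarrow> 'u \<Rightarrow> 'w::zero) \<Rightarrow> nat"
  where "isotropy_index sU \<psi> = Max (isotropic_dims sU \<psi>)"

text \<open>
  Direct sums are modelled by product types, with the componentwise scalar multiplication
  \<open>module_prod.scale\<close>; the summands sit inside as \<open>{(a, 0)}\<close> and \<open>{(0, b)}\<close>, and a direct sum
  of subspaces of the summands is a Cartesian product.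
\<close>

definition direct_sum_map ::
  "('l1 \<Rightarrow> 'l1 \<Rightarrow> 'v1) \<Rightarrow> ('l2 \<Rightarrow> 'l2 \<Rightarrow> 'v2) \<Rightarrow> 'l1 \<times> 'l2 \<Rightarrow> 'l1 \<times> 'l2 \<Rightarrow> 'v1 \<times> 'v2"
  where "direct_sum_map \<phi>1 \<phi>2 x y = (\<phi>1 (fst x) (fst y), \<phi>2 (snd x) (snd y))"

text \<open>
  The direct sum map is bilinear and skew-symmetric, and it is the only such map that restricts to
  the given maps on the summands and vanishes across them.
\<close>

lemma bilinear_map_direct_sum:
  assumes b1: "bilinear_map sL1 sV1 \<phi>1" and b2: "bilinear_map sL2 sV2 \<phi>2"
  shows "bilinear_map (module_prod.scale sL1 sL2) (module_prod.scale sV1 sV2)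
    (direct_sum_map \<phi>1 \<phi>2)"
proof -
  have l1: "Vector_Spaces.linear sL1 sV1 (\<phi>1 x)" "Vector_Spaces.linear sL1 sV1 (\<lambda>x. \<phi>1 x y)" for x y
    using b1 by (auto simp: bilinear_map_def)
  have l2: "Vector_Spaces.linear sL2 sV2 (\<phi>2 x)" "Vector_Spaces.linear sL2 sV2 (\<lambda>x. \<phi>2 x y)" for x y
    using b2 by (auto simp: bilinear_map_def)
  interpret L1: vector_space sL1 using l1(1) by (simp add: Vector_Spaces.linear_def)
  interpret V1: vector_space sV1 using l1(1) by (simp add: Vector_Spaces.linear_def)
  interpret L2: vector_space sL2 using l2(1) by (simp add: Vector_Spaces.linear_def)
  interpret V2: vector_space sV2 using l2(1) by (simp add: Vector_Spaces.linear_def)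
  interpret L: vector_space_prod sL1 sL2 by unfold_locales
  interpret V: vector_space_prod sV1 sV2 by unfold_locales
  have lin: "Vector_Spaces.linear (module_prod.scale sL1 sL2) (module_prod.scale sV1 sV2)
      (\<lambda>x. (f (fst x), g (snd x)))"
    if "Vector_Spaces.linear sL1 sV1 f" "Vector_Spaces.linear sL2 sV2 g" for f g
  proof -
    interpret f: Vector_Spaces.linear sL1 sV1 f by fact
    interpret g: Vector_Spaces.linear sL2 sV2 g by fact
    show ?thesis
      by unfold_locales
        (simp_all add: L.scale_def V.scale_def f.add g.add f.scale g.scale)
  qed
  show ?thesis
    unfolding bilinear_map_def direct_sum_map_def by (auto intro!: lin l1 l2)
qed

lemma skew_symmetric_direct_sum:
  "skew_symmetric \<phi>1 \<Longrightarrow> skew_symmetric \<phi>2 \<Longrightarrow> skew_symmetric (direct_sum_map \<phi>1 \<phi>2)"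
  unfolding skew_symmetric_def direct_sum_map_def uminus_prod_def fst_conv snd_conv by metis

lemma direct_sum_map_unique:
  assumes "bilinear_map sL1 sV1 \<phi>1" and "bilinear_map sL2 sV2 \<phi>2"
    and b: "bilinear_map (module_prod.scale sL1 sL2) (module_prod.scale sV1 sV2) \<phi>"
    and s: "skew_symmetric \<phi>"
  shows "\<phi> = direct_sum_map \<phi>1 \<phi>2 \<longleftrightarrow>
    (\<forall>a a'. \<phi> (a, 0) (a', 0) = (\<phi>1 a a', 0)) \<and>
    (\<forall>b b'. \<phi> (0, b) (0, b') = (0, \<phi>2 b b')) \<and>
    (\<forall>a b. \<phi> (a, 0) (0, b) = 0)" (is "_ \<longleftrightarrow> ?R")
proof
  have zero: "f 0 = 0" if "Vector_Spaces.linear s t f" for f s t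
    using that Vector_Spaces.linear.axioms(3) module_hom.zero by blast
  have z1: "\<phi>1 0 a = 0" "\<phi>1 a 0 = 0" for a
    using assms(1) zero[of sL1 sV1 "\<phi>1 a"] zero[of sL1 sV1 "\<lambda>x. \<phi>1 x a"]
    by (auto simp: bilinear_map_def)
  have z2: "\<phi>2 0 a = 0" "\<phi>2 a 0 = 0" for a
    using assms(2) zero[of sL2 sV2 "\<phi>2 a"] zero[of sL2 sV2 "\<lambda>x. \<phi>2 x a"]
    by (auto simp: bilinear_map_def)
  show "\<phi> = direct_sum_map \<phi>1 \<phi>2 \<Longrightarrow> ?R"
    by (simp add: direct_sum_map_def z1 z2 zero_prod_def)
next
  assume R: ?R
  have add: "f (x + y) = f x + f y" if "Vector_Spaces.linear s t f" for f s t x y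
    using that Vector_Spaces.linear.axioms(3) module_hom.add by blast
  let ?sL = "module_prod.scale sL1 sL2" and ?sV = "module_prod.scale sV1 sV2"
  have addl: "\<phi> (x + x') y = \<phi> x y + \<phi> x' y" for x x' y
    by (rule add[of ?sL ?sV "\<lambda>x. \<phi> x y"])
      (use b in \<open>simp only: bilinear_map_def\<close>)
  have addr: "\<phi> x (y + y') = \<phi> x y + \<phi> x y'" for x y y'
    by (rule add[of ?sL ?sV "\<phi> x"]) (use b in \<open>simp only: bilinear_map_def\<close>)
  have R': "\<phi> (0, b) (a, 0) = 0" for a b
    using s R by (metis skew_symmetric_def minus_zero)
  have "\<phi> (a, b) (a', b') = direct_sum_map \<phi>1 \<phi>2 (a, b) (a', b')" for a b a' b'
    using addl[of "(a, 0)" "(0, b)" "(a', b')"] addr[of "(a, 0)" "(a', 0)" "(0, b')"]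
      addr[of "(0, b)" "(a', 0)" "(0, b')"] R R'
    by (simp add: direct_sum_map_def)
  then show "\<phi> = direct_sum_map \<phi>1 \<phi>2" by (simp add: fun_eq_iff)
qed

end

theory Submission
  imports Defs
begin

text \<open>
  Two dual observations give the description of the maximal isotropic subspaces. Because the direct
  sum map is computed componentwise, the projections of an isotropic subspace \<open>H\<close> to the two
  summands are isotropic, and conversely the product of isotropic subspaces is isotropic. Hence
  \<open>H\<close> lies in the isotropic subspace \<open>fst ` H \<times> snd ` H\<close>, so a maximal \<open>H\<close> equals it
  (\<open>maximal_isotropic_eq_Times\<close>). Since products and projections are monotone, maximality passes
  between \<open>H1 \<times> H2\<close> and its factors in both directions (\<open>maximal_isotropic_Times_iff\<close>).

  The dimension of a product is the sum of the dimensions, which turns this description into the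
  equality of the sets of dimensions. The statement about the isotropy indices then needs only that
  the maximum of a sum of two sets of numbers is the sum of their maxima (\<open>Max_set_plus\<close>). This
  requires the sets to be finite and nonempty: dimensions are bounded by that of the whole space, and
  an isotropic subspace of largest dimension is maximal.
\<close>

lemma Max_set_plus:
  fixes A B :: "'a::linordered_ab_semigroup_add set"
  assumes "finite A" "A \<noteq> {}" "finite B" "B \<noteq> {}"
  shows "Max (A + B) = Max A + Max B"
proof (rule Max_eqI)
  show "finite (A + B)" using assms by (simp add: finite_set_plus)
  show "Max A + Max B \<in> A + B" using assms by (intro set_plus_intro Max_in)
  show "y \<le> Max A + Max B" if "y \<in> A + B" for y
    using that assms by (auto elim!: set_plus_elim intro!: add_mono)
qed

context vector_space_prod
begin

lemma isotropic_Times: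
  assumes "isotropic s1 \<phi>1 H1" "isotropic s2 \<phi>2 H2"
  shows "isotropic scale (direct_sum_map \<phi>1 \<phi>2) (H1 \<times> H2)"
  using assms by (auto simp: isotropic_def direct_sum_map_def zero_prod_def subspace_Times)

lemma isotropic_fst:
  assumes "isotropic scale (direct_sum_map \<phi>1 \<phi>2) H"
  shows "isotropic s1 \<phi>1 (fst ` H)"
proof -
  interpret f: Vector_Spaces.linear scale s1 fst by (rule linear_fst)
  show ?thesis
    using assms f.subspace_image by (auto simp: isotropic_def direct_sum_map_def zero_prod_def)
qed

lemma isotropic_snd:
  assumes "isotropic scale (direct_sum_map \<phi>1 \<phi>2) H"
  shows "isotropic s2 \<phi>2 (snd ` H)"
proof -
  interpret f: Vector_Spaces.linear scale s2 snd by (rule linear_snd)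
  show ?thesis
    using assms f.subspace_image by (auto simp: isotropic_def direct_sum_map_def zero_prod_def)
qed

text \<open>
  The product of the projections is an isotropic subspace that contains the given one, so by
  maximality it cannot be larger.
\<close>

lemma maximal_isotropic_eq_Times:
  assumes "maximal_isotropic scale (direct_sum_map \<phi>1 \<phi>2) H"
  shows "H = fst ` H \<times> snd ` H"
proof -
  have "isotropic scale (direct_sum_map \<phi>1 \<phi>2) (fst ` H \<times> snd ` H)"
    using assms by (intro isotropic_Times isotropic_fst isotropic_snd)
      (auto simp: maximal_isotropic_def)
  moreover have "H \<subseteq> fst ` H \<times> snd ` H" by force
  ultimately show ?thesis using assms by (auto simp: maximal_isotropic_def psubset_eq)
qed

text \<open>
  Enlarging a factor enlarges the product, and enlarging the product enlarges a projection. Both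
  steps rely on the factors being nonempty, as subspaces are.
\<close>

lemma maximal_isotropic_Times_iff:
  "maximal_isotropic scale (direct_sum_map \<phi>1 \<phi>2) (H1 \<times> H2) \<longleftrightarrow>
    maximal_isotropic s1 \<phi>1 H1 \<and> maximal_isotropic s2 \<phi>2 H2" (is "?max \<longleftrightarrow> _")
proof (intro iffI conjI)
  assume max: ?max
  then have iso: "isotropic scale (direct_sum_map \<phi>1 \<phi>2) (H1 \<times> H2)"
    by (simp add: maximal_isotropic_def)
  then have ne: "0 \<in> H1" "0 \<in> H2"
    using p.subspace_0[of "H1 \<times> H2"] by (auto simp: isotropic_def zero_prod_def)
  have i1: "isotropic s1 \<phi>1 H1" and i2: "isotropic s2 \<phi>2 H2"
    using isotropic_fst[OF iso] isotropic_snd[OF iso] ne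
    by (auto simp: fst_image_times snd_image_times split: if_splits)
  show "maximal_isotropic s1 \<phi>1 H1" unfolding maximal_isotropic_def
  proof (intro conjI notI i1)
    assume "\<exists>K. isotropic s1 \<phi>1 K \<and> H1 \<subset> K"
    then obtain K where "isotropic s1 \<phi>1 K" "H1 \<subset> K" by blast
    moreover from this have "H1 \<times> H2 \<subset> K \<times> H2" using ne by blast
    ultimately show False using max isotropic_Times i2 unfolding maximal_isotropic_def by blast
  qed
  show "maximal_isotropic s2 \<phi>2 H2" unfolding maximal_isotropic_def
  proof (intro conjI notI i2)
    assume "\<exists>K. isotropic s2 \<phi>2 K \<and> H2 \<subset> K"
    then obtain K where "isotropic s2 \<phi>2 K" "H2 \<subset> K" by blast
    moreover from this have "H1 \<times> H2 \<subset> H1 \<times> K" using ne by blast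
    ultimately show False using max isotropic_Times i1 unfolding maximal_isotropic_def by blast
  qed
next
  assume max: "maximal_isotropic s1 \<phi>1 H1 \<and> maximal_isotropic s2 \<phi>2 H2"
  then have i1: "isotropic s1 \<phi>1 H1" and i2: "isotropic s2 \<phi>2 H2"
    by (auto simp: maximal_isotropic_def)
  then have ne: "0 \<in> H1" "0 \<in> H2"
    by (auto simp: isotropic_def vs1.subspace_0 vs2.subspace_0)
  show ?max unfolding maximal_isotropic_def
  proof (intro conjI notI isotropic_Times i1 i2)
    assume "\<exists>K. isotropic scale (direct_sum_map \<phi>1 \<phi>2) K \<and> H1 \<times> H2 \<subset> K"
    then obtain K where K: "isotropic scale (direct_sum_map \<phi>1 \<phi>2) K" "H1 \<times> H2 \<subset> K" by blast
    have "H1 \<subseteq> fst ` K" "H2 \<subseteq> snd ` K" using K(2) ne by force+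
    then have "fst ` K = H1" "snd ` K = H2"
      using max isotropic_fst[OF K(1)] isotropic_snd[OF K(1)]
      by (auto simp: maximal_isotropic_def psubset_eq)
    then have "K \<subseteq> H1 \<times> H2" by force
    with K(2) show False by blast
  qed
qed

lemma maximal_isotropic_direct_sum_iff:
  "maximal_isotropic scale (direct_sum_map \<phi>1 \<phi>2) H \<longleftrightarrow>
    (\<exists>H1 H2. maximal_isotropic s1 \<phi>1 H1 \<and> maximal_isotropic s2 \<phi>2 H2 \<and> H = H1 \<times> H2)"
  by (metis maximal_isotropic_eq_Times maximal_isotropic_Times_iff)

end

lemma (in finite_dimensional_vector_space_prod) isotropic_dims_direct_sum:
  "isotropic_dims scale (direct_sum_map \<phi>1 \<phi>2) = isotropic_dims s1 \<phi>1 + isotropic_dims s2 \<phi>2"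
proof -
  have dim: "p.dim (H1 \<times> H2) = vs1.dim H1 + vs2.dim H2"
    if "maximal_isotropic s1 \<phi>1 H1" "maximal_isotropic s2 \<phi>2 H2" for H1 H2
    using that by (intro dim_Times) (auto simp: maximal_isotropic_def isotropic_def)
  show ?thesis (is "?D = ?D1 + ?D2")
  proof (intro equalityI subsetI)
    fix n assume "n \<in> ?D"
    then show "n \<in> ?D1 + ?D2"
      by (auto simp: isotropic_dims_def maximal_isotropic_direct_sum_iff dim
          intro!: set_plus_intro)
  next
    fix n assume "n \<in> ?D1 + ?D2"
    then obtain H1 H2 where H: "maximal_isotropic s1 \<phi>1 H1" "maximal_isotropic s2 \<phi>2 H2"
      and n: "n = vs1.dim H1 + vs2.dim H2"
      by (auto simp: isotropic_dims_def elim!: set_plus_elim)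
    have "maximal_isotropic scale (direct_sum_map \<phi>1 \<phi>2) (H1 \<times> H2)"
      using H by (simp add: maximal_isotropic_Times_iff)
    moreover have "n = p.dim (H1 \<times> H2)" using dim[OF H] n by simp
    ultimately show "n \<in> ?D" unfolding isotropic_dims_def by blast
  qed
qed

context finite_dimensional_vector_space
begin

lemma finite_isotropic_dims: "finite (isotropic_dims scale \<psi>)"
  by (rule finite_subset[of _ "{..dimension}"]) (auto simp: isotropic_dims_def dim_subset_UNIV)

text \<open>
  The zero subspace is isotropic as soon as \<open>\<psi> 0 0 = 0\<close>, and among the isotropic subspaces one of
  largest dimension is maximal, because a proper inclusion of subspaces raises the dimension.
\<close>

lemma isotropic_dims_nonempty:
  assumes "\<psi> 0 0 = 0"
  shows "isotropic_dims scale \<psi> \<noteq> {}"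
proof -
  have "isotropic scale \<psi> {0}" using assms by (simp add: isotropic_def subspace_single_0)
  then obtain H where H: "isotropic scale \<psi> H" "\<And>K. isotropic scale \<psi> K \<Longrightarrow> dim K \<le> dim H"
    using ex_has_greatest_nat[of "isotropic scale \<psi>" "{0}" dim "Suc dimension"] dim_subset_UNIV
    by (metis less_Suc_eq_le)
  have "maximal_isotropic scale \<psi> H"
    unfolding maximal_isotropic_def
  proof (intro conjI notI H(1))
    assume "\<exists>K. isotropic scale \<psi> K \<and> H \<subset> K"
    then obtain K where K: "isotropic scale \<psi> K" "H \<subset> K" by blast
    then have "H = K"
      using H(1) H(2)[OF K(1)] by (intro subspace_dim_equal) (auto simp: isotropic_def)
    with K(2) show False by blast
  qed
  then show ?thesis by (auto simp: isotropic_dims_def)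
qed

end

lemma bilinear_map_zero_zero:
  assumes "bilinear_map sU sW \<psi>"
  shows "\<psi> 0 0 = 0"
proof -
  interpret Vector_Spaces.linear sU sW "\<psi> 0" using assms by (simp add: bilinear_map_def)
  show ?thesis by (rule zero)
qed

theorem lemma20:
  fixes sL1 :: "'f::field \<Rightarrow> 'l1::ab_group_add \<Rightarrow> 'l1"
    and sL2 :: "'f \<Rightarrow> 'l2::ab_group_add \<Rightarrow> 'l2"
    and sV1 :: "'f \<Rightarrow> 'v1::ab_group_add \<Rightarrow> 'v1"
    and sV2 :: "'f \<Rightarrow> 'v2::ab_group_add \<Rightarrow> 'v2"
    and \<phi>1 :: "'l1 \<Rightarrow> 'l1 \<Rightarrow> 'v1"
    and \<phi>2 :: "'l2 \<Rightarrow> 'l2 \<Rightarrow> 'v2"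
  defines "sL \<equiv> module_prod.scale sL1 sL2"
    and "\<phi> \<equiv> direct_sum_map \<phi>1 \<phi>2"
  assumes "fin_dim_vector_space sL1" and "fin_dim_vector_space sL2"
    and "fin_dim_vector_space sV1" and "fin_dim_vector_space sV2"
    and "bilinear_map sL1 sV1 \<phi>1" and "skew_symmetric \<phi>1"
    and "bilinear_map sL2 sV2 \<phi>2" and "skew_symmetric \<phi>2"
  shows "(\<forall>H. module.subspace sL H \<longrightarrow>
            (maximal_isotropic sL \<phi> H \<longleftrightarrow>
              (\<exists>H1 H2. maximal_isotropic sL1 \<phi>1 H1 \<and> maximal_isotropic sL2 \<phi>2 H2 \<and>
                 H = H1 \<times> H2))) \<and>
         isotropic_dims sL \<phi> = isotropic_dims sL1 \<phi>1 + isotropic_dims sL2 \<phi>2 \<and>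
         isotropy_index sL \<phi> = isotropy_index sL1 \<phi>1 + isotropy_index sL2 \<phi>2"
proof -
  obtain B1 where "finite_dimensional_vector_space sL1 B1"
    using assms(3) by (auto simp: fin_dim_vector_space_def)
  then interpret L1: finite_dimensional_vector_space sL1 B1 .
  obtain B2 where "finite_dimensional_vector_space sL2 B2"
    using assms(4) by (auto simp: fin_dim_vector_space_def)
  then interpret L2: finite_dimensional_vector_space sL2 B2 .
  interpret L: finite_dimensional_vector_space_prod sL1 sL2 B1 B2 by unfold_locales
  have dims: "isotropic_dims sL \<phi> = isotropic_dims sL1 \<phi>1 + isotropic_dims sL2 \<phi>2"
    unfolding sL_def \<phi>_def by (rule L.isotropic_dims_direct_sum)
  have "isotropy_index sL \<phi> = isotropy_index sL1 \<phi>1 + isotropy_index sL2 \<phi>2"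
    unfolding isotropy_index_def dims using assms(7,9)
    by (intro Max_set_plus L1.finite_isotropic_dims L2.finite_isotropic_dims
        L1.isotropic_dims_nonempty L2.isotropic_dims_nonempty bilinear_map_zero_zero)
  with dims show ?thesis
    unfolding sL_def \<phi>_def by (simp add: L.maximal_isotropic_direct_sum_iff)
qed

end
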